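(* The second eigenvalue of $K_*$ satisfies $$\lambda_2(K_* )\le a_{\mathrm S}:=\frac{9+\sqrt3}{8}.$$
   Context: $K_*$ is the bounded, compact, positive self-adjoint operator on $L^2(0,1)$ given by $K_*f(x)=\int_0^1|x-y|^{-1/2}f(y)\,dy$. Its eigenvalues are listed in decreasing order with multiplicity, $\lambda_1(K_* )\ge\lambda_2(K_* )\ge\cdots\ge0$. *)

theory Defs
  imports "HOL-Analysis.Analysis" "HOL-Library.Extended_Nat"
begin

definition lborel01 :: "real measure" where
  "lborel01 = restrict_space lborel {0<..<1}"

text \<open>Elements of \<open>L\<^sup>2(M)\<close> are represented by measurable functions; the identification of functions
  that agree almost everywhere is built into the notions below (all equations hold only
  almost everywhere). Every class over Lebesgue measure has a Borel representative.\<close>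

definition L2 :: "'a measure \<Rightarrow> ('a \<Rightarrow> real) set" where
  "L2 M = {f \<in> borel_measurable M. integrable M (\<lambda>x. (f x)\<^sup>2)}"

text \<open>For \<open>f \<in> L2 lborel01\<close> the integrand is integrable for almost every \<open>x\<close> in \<open>(0,1)\<close>; on
  the exceptional null set, where the integral is \<open>0\<close> by convention, the value is immaterial.
  So is the value \<open>0 powr (-1/2) = 0\<close> on the diagonal.\<close>

definition K_star :: "(real \<Rightarrow> real) \<Rightarrow> real \<Rightarrow> real" where
  "K_star f x = (LINT y|lborel01. \<bar>x - y\<bar> powr (-1/2) * f y)"

definition eigenspace :: "'a measure \<Rightarrow> (('a \<Rightarrow> real) \<Rightarrow> 'a \<Rightarrow> real) \<Rightarrow> real \<Rightarrow> ('a \<Rightarrow> real) set" where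
  "eigenspace M T \<mu> = {f \<in> L2 M. AE x in M. T f x = \<mu> * f x}"

text \<open>Linear independence of the classes of \<open>f 0, \<dots>, f (n - 1)\<close> modulo null functions.\<close>

definition indep_ae :: "'a measure \<Rightarrow> nat \<Rightarrow> (nat \<Rightarrow> 'a \<Rightarrow> real) \<Rightarrow> bool" where
  "indep_ae M n f \<longleftrightarrow>
     (\<forall>c :: nat \<Rightarrow> real. (AE x in M. (\<Sum>i<n. c i * f i x) = 0) \<longrightarrow> (\<forall>i<n. c i = 0))"

definition dim_ae :: "'a measure \<Rightarrow> ('a \<Rightarrow> real) set \<Rightarrow> enat" where
  "dim_ae M V = (SUP n \<in> {n. \<exists>f. (\<forall>i<n. f i \<in> V) \<and> indep_ae M n f}. enat n)"

text \<open>The number of eigenvalues in \<open>[t, \<infinity>)\<close> counted with multiplicity, that is, the sum over all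
  \<open>\<mu> \<ge> t\<close> of the dimension of the eigenspace, which is \<open>0\<close> unless \<open>\<mu>\<close> is an eigenvalue.\<close>

definition eigenvalue_count :: "'a measure \<Rightarrow> (('a \<Rightarrow> real) \<Rightarrow> 'a \<Rightarrow> real) \<Rightarrow> real \<Rightarrow> enat" where
  "eigenvalue_count M T t =
     (SUP F \<in> {F. finite F \<and> F \<subseteq> {t..}}. \<Sum>\<mu>\<in>F. dim_ae M (eigenspace M T \<mu>))"

text \<open>For a compact positive operator \<open>T\<close> and \<open>n \<ge> 1\<close>, the \<open>n\<close>-th entry \<open>\<lambda>\<^sub>n(T)\<close> of the list of
  eigenvalues in decreasing order with multiplicity: the largest \<open>t\<close> such that at least \<open>n\<close>
  entries are \<open>\<ge> t\<close>. If there are fewer than \<open>n\<close> positive entries, then \<open>\<lambda>\<^sub>n(T) = 0\<close>.\<close>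

definition nth_eigenvalue :: "'a measure \<Rightarrow> (('a \<Rightarrow> real) \<Rightarrow> 'a \<Rightarrow> real) \<Rightarrow> nat \<Rightarrow> real" where
  "nth_eigenvalue M T n = Sup (insert 0 {t. 0 < t \<and> enat n \<le> eigenvalue_count M T t})"

end

theory Submission
  imports Defs
begin

text \<open>
  Subtracting the constant \<open>2\<close> from the kernel \<open>\<bar>x - y\<bar> powr (-1/2)\<close> is a perturbation of rank one,
  so by the min-max principle the second eigenvalue of \<open>K_star\<close> is at most the largest
  eigenvalue of the perturbed operator, and this is at most the largest \<open>L\<^sup>1\<close> norm of a row
  of the perturbed kernel (Schur's test).

  For a symmetric kernel \<open>k\<close> and \<open>\<phi> \<in> L\<^sup>2\<close> the argument (\<open>second_eigenvalue_le\<close>) runs as follows. If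
  two eigenvalues, counted with multiplicity, are at least \<open>t\<close>, then there are linearly independent
  eigenfunctions \<open>f\<close> and \<open>g\<close> for them, and some nonzero \<open>h = a f + b g\<close> is orthogonal to \<open>\<phi>\<close>. On the
  one hand the quadratic form of \<open>k\<close> at \<open>h\<close> is at least \<open>t \<parallel>h\<parallel>\<^sup>2\<close>, because eigenfunctions for
  different eigenvalues are orthogonal (\<open>kernel_form_span_lower_bound\<close>). On the other hand
  it does not change at \<open>h\<close> when \<open>\<phi>(x) \<phi>(y)\<close> is subtracted from \<open>k\<close>, so Schur's test for the
  difference bounds it by \<open>A \<parallel>h\<parallel>\<^sup>2\<close> (\<open>kernel_form_upper_bound\<close>). Hence \<open>t \<le> A\<close>.

  For \<open>\<phi> = sqrt 2\<close> the row integral at \<open>x\<close> splits at the diagonal into two explicit pieces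
  (\<open>row_integral\<close>). On \<open>[0, 1/4]\<close> the sum is \<open>3 - 2 sqrt (1 - x) + 2 sqrt x - 4 x\<close>. The chord of the
  convex term \<open>- 2 sqrt (1 - x)\<close> makes this \<open>1 + 2 sqrt x - 4 (sqrt 3 - 1) x\<close>, whose maximum over
  all \<open>x \<ge> 0\<close> is exactly \<open>(9 + sqrt 3) / 8\<close>. On \<open>[1/4, 3/4]\<close> the row integral is at most
  \<open>3 - sqrt 3\<close>, which is smaller, and \<open>[3/4, 1]\<close> follows by reflection.
\<close>

section \<open>Eigenfunctions from eigenvalue counts\<close>

lemma indep_ae_mono:
  assumes "indep_ae M n f" and "m \<le> n"
  shows "indep_ae M m f"
  unfolding indep_ae_def
proof (intro allI impI)
  fix c :: "nat \<Rightarrow> real" and i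
  assume ae: "AE x in M. (\<Sum>i<m. c i * f i x) = 0" and i: "i < m"
  define d where "d j = (if j < m then c j else 0)" for j
  have "(\<Sum>j<n. d j * f j x) = (\<Sum>j<m. c j * f j x)" for x
    by (rule sum.mono_neutral_cong_right) (use assms(2) in \<open>auto simp: d_def\<close>)
  then have "AE x in M. (\<Sum>j<n. d j * f j x) = 0" using ae by simp
  then have "\<forall>j<n. d j = 0" using assms(1) unfolding indep_ae_def by blast
  then have "d i = 0" using i assms(2) by simp
  then show "c i = 0" using i by (simp add: d_def)
qed

text \<open>The supremum in the dimension is attained because a set of extended naturals whose supremum is
  at least the finite number \<open>n + 1\<close> has a member above \<open>n\<close>; longer independent families are cut off.\<close>

lemma dim_ae_geD:
  assumes "enat (Suc n) \<le> dim_ae M V"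
  shows "\<exists>f. (\<forall>i<Suc n. f i \<in> V) \<and> indep_ae M (Suc n) f"
proof (rule ccontr)
  assume no: "\<not> ?thesis"
  have "m \<le> n" if "\<forall>i<m. f i \<in> V" "indep_ae M m f" for m f
    using no that indep_ae_mono[of M m f "Suc n"] by (metis not_less_eq_eq order_less_le_trans)
  then have "dim_ae M V \<le> enat n"
    unfolding dim_ae_def by (intro SUP_least) auto
  with assms show False
    by (meson Suc_n_not_le_n enat_ord_simps(1) order_trans)
qed

text \<open>A count of two arises from one eigenspace of dimension at least two or from two different
  eigenvalues. In the second case independence will come from the orthogonality of eigenfunctions
  of a symmetric kernel.\<close>

lemma two_eigenfunctions_of_eigenvalue_count:
  assumes "2 \<le> eigenvalue_count M T t"
  obtains \<mu> \<nu> f g where "t \<le> \<mu>" "t \<le> \<nu>" "f \<in> eigenspace M T \<mu>" "g \<in> eigenspace M T \<nu>"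
    "\<mu> = \<nu> \<and> (\<forall>a b. (AE x in M. a * f x + b * g x = 0) \<longrightarrow> a = 0 \<and> b = 0)
      \<or> \<mu> \<noteq> \<nu> \<and> \<not> (AE x in M. f x = 0) \<and> \<not> (AE x in M. g x = 0)"
proof -
  let ?d = "\<lambda>\<mu>. dim_ae M (eigenspace M T \<mu>)"
  have "\<exists>F. finite F \<and> F \<subseteq> {t..} \<and> \<not> sum ?d F \<le> 1"
  proof (rule ccontr)
    assume "\<not> ?thesis"
    then have "eigenvalue_count M T t \<le> 1"
      unfolding eigenvalue_count_def by (intro SUP_least) auto
    with assms have "(2::enat) \<le> 1" by (rule order_trans)
    then show False by simp
  qed
  then obtain F where F: "finite F" "F \<subseteq> {t..}" "\<not> sum ?d F \<le> 1" by blast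
  show thesis
  proof (cases "\<exists>\<mu>\<in>F. 2 \<le> ?d \<mu>")
    case True
    then obtain \<mu> where \<mu>: "\<mu> \<in> F" "enat (Suc 1) \<le> ?d \<mu>"
      by (auto simp: numeral_eq_enat numeral_2_eq_2)
    from dim_ae_geD[OF \<mu>(2)] obtain f
      where f: "\<forall>i<Suc 1. f i \<in> eigenspace M T \<mu>" "indep_ae M (Suc 1) f" by blast
    have "a = 0 \<and> b = 0" if "AE x in M. a * f 0 x + b * f 1 x = 0" for a b
      using f(2)[unfolded indep_ae_def, rule_format, of "\<lambda>i. if i = 0 then a else b" 0]
        f(2)[unfolded indep_ae_def, rule_format, of "\<lambda>i. if i = 0 then a else b" 1] that
      by simp
    moreover have "f 0 \<in> eigenspace M T \<mu>" "f 1 \<in> eigenspace M T \<mu>" "t \<le> \<mu>"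
      using f(1) \<mu>(1) F(2) by auto
    ultimately show thesis using that[of \<mu> \<mu> "f 0" "f 1"] by blast
  next
    case False
    have le1: "?d \<mu> \<le> 1" if "\<mu> \<in> F" for \<mu>
    proof -
      have "?d \<mu> < 2" using False that by (simp add: not_le)
      then show ?thesis by (cases "?d \<mu>") (auto simp: numeral_eq_enat one_enat_def)
    qed
    obtain \<mu> where \<mu>: "\<mu> \<in> F" "?d \<mu> \<noteq> 0"
    proof -
      have "sum ?d F \<noteq> 0" using F(3) by (metis zero_le)
      then have "\<not> (\<forall>\<mu>\<in>F. ?d \<mu> = 0)" using sum.neutral[of F ?d] by blast
      then show thesis using that by blast
    qed
    have "sum ?d F = ?d \<mu> + sum ?d (F - {\<mu>})"
      using F(1) \<mu>(1) by (simp add: sum.remove)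
    obtain \<nu> where \<nu>: "\<nu> \<in> F - {\<mu>}" "?d \<nu> \<noteq> 0"
    proof -
      have "sum ?d (F - {\<mu>}) \<noteq> 0"
        using F(3) le1[OF \<mu>(1)] \<open>sum ?d F = ?d \<mu> + sum ?d (F - {\<mu>})\<close> by auto
      then have "\<not> (\<forall>\<nu>\<in>F - {\<mu>}. ?d \<nu> = 0)" using sum.neutral[of "F - {\<mu>}" ?d] by blast
      then show thesis using that by blast
    qed
    have nonzero: "\<exists>f\<in>eigenspace M T \<kappa>. \<not> (AE x in M. f x = 0)" if "?d \<kappa> \<noteq> 0" for \<kappa>
    proof -
      have "enat (Suc 0) \<le> ?d \<kappa>"
        using that by (simp add: Suc_ile_eq zero_enat_def[symmetric])
      from dim_ae_geD[OF this] obtain f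
        where f: "f 0 \<in> eigenspace M T \<kappa>" "indep_ae M (Suc 0) f" by auto
      then show ?thesis
        using f(2)[unfolded indep_ae_def, rule_format, of "\<lambda>_. 1" 0] by auto
    qed
    obtain f g where "f \<in> eigenspace M T \<mu>" "\<not> (AE x in M. f x = 0)"
      and "g \<in> eigenspace M T \<nu>" "\<not> (AE x in M. g x = 0)"
      using nonzero[OF \<mu>(2)] nonzero[OF \<nu>(2)] by blast
    moreover have "t \<le> \<mu>" "t \<le> \<nu>" "\<mu> \<noteq> \<nu>" using \<mu>(1) \<nu>(1) F(2) by auto
    ultimately show thesis using that[of \<mu> \<nu> f g] by simp
  qed
qed

section \<open>Square-integrable functions\<close>

lemma L2_measurable: "f \<in> L2 M \<Longrightarrow> f \<in> borel_measurable M"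
  and L2_square_integrable: "f \<in> L2 M \<Longrightarrow> integrable M (\<lambda>x. (f x)\<^sup>2)"
  by (auto simp: L2_def)

lemma integrable_mult_L2:
  assumes "f \<in> L2 M" and "g \<in> L2 M"
  shows "integrable M (\<lambda>x. f x * g x)"
proof (rule Bochner_Integration.integrable_bound)
  show "integrable M (\<lambda>x. (f x)\<^sup>2 + (g x)\<^sup>2)"
    using assms by (auto simp: L2_def)
  show "(\<lambda>x. f x * g x) \<in> borel_measurable M"
    using assms by (auto simp: L2_def)
  have "\<bar>a * b\<bar> \<le> a\<^sup>2 + b\<^sup>2" for a b :: real
    using sum_squares_bound[of "\<bar>a\<bar>" "\<bar>b\<bar>"] abs_ge_zero[of "a * b"]
    unfolding abs_mult power2_abs by linarith
  then show "AE x in M. norm (f x * g x) \<le> norm ((f x)\<^sup>2 + (g x)\<^sup>2)"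
    by simp
qed

lemma lincomb_L2:
  assumes f: "f \<in> L2 M" and g: "g \<in> L2 M"
  shows "(\<lambda>x. a * f x + b * g x) \<in> L2 M"
proof -
  have "integrable M (\<lambda>x. a\<^sup>2 * (f x)\<^sup>2 + b\<^sup>2 * (g x)\<^sup>2 + 2 * a * b * (f x * g x))"
    using L2_square_integrable[OF f] L2_square_integrable[OF g] integrable_mult_L2[OF f g]
    by simp
  then have "integrable M (\<lambda>x. (a * f x + b * g x)\<^sup>2)"
    by (simp add: power2_eq_square algebra_simps)
  then show ?thesis
    using L2_measurable[OF f] L2_measurable[OF g] by (simp add: L2_def)
qed

lemma L2_norm_eq_0_iff:
  assumes "f \<in> L2 M"
  shows "(LINT x|M. (f x)\<^sup>2) = 0 \<longleftrightarrow> (AE x in M. f x = 0)"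
  using integral_nonneg_eq_0_iff_AE[OF L2_square_integrable[OF assms]] by simp

section \<open>The quadratic form of a symmetric kernel\<close>

text \<open>The form is an integral over the product space, so that symmetry and bilinearity become
  properties of a single integral of an absolutely integrable function.\<close>

definition kernel_form ::
  "'a measure \<Rightarrow> ('a \<Rightarrow> 'a \<Rightarrow> real) \<Rightarrow> ('a \<Rightarrow> real) \<Rightarrow> ('a \<Rightarrow> real) \<Rightarrow> real" where
  "kernel_form M k f g = (LINT z|(M \<Otimes>\<^sub>M M). k (fst z) (snd z) * f (fst z) * g (snd z))"

definition kernel_operator ::
  "'a measure \<Rightarrow> ('a \<Rightarrow> 'a \<Rightarrow> real) \<Rightarrow> ('a \<Rightarrow> real) \<Rightarrow> 'a \<Rightarrow> real" where
  "kernel_operator M k f x = (LINT y|M. k x y * f y)"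

text \<open>The bound on the rows is the hypothesis of Schur's test with constant weight; by symmetry it
  also bounds the columns.\<close>

locale symmetric_kernel = sigma_finite_measure M for M :: "'a measure" +
  fixes k :: "'a \<Rightarrow> 'a \<Rightarrow> real" and C :: real
  assumes kernel_measurable: "(\<lambda>z. k (fst z) (snd z)) \<in> borel_measurable (M \<Otimes>\<^sub>M M)"
    and kernel_symmetric: "\<And>x y. x \<in> space M \<Longrightarrow> y \<in> space M \<Longrightarrow> k x y = k y x"
    and row_bound: "\<And>x. x \<in> space M \<Longrightarrow> (\<integral>\<^sup>+ y. ennreal \<bar>k x y\<bar> \<partial>M) \<le> ennreal C"
    and C_nonneg: "0 \<le> C"
begin

sublocale P: pair_sigma_finite M M ..

text \<open>Integrating over \<open>y\<close> first leaves the row integral, at most \<open>C\<close>, as a weight of \<open>(f x)\<^sup>2\<close>.\<close>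

lemma weighted_square:
  assumes f: "f \<in> L2 M"
  shows "integrable (M \<Otimes>\<^sub>M M) (\<lambda>z. \<bar>k (fst z) (snd z)\<bar> * (f (fst z))\<^sup>2)" (is ?int)
    and "(LINT z|(M \<Otimes>\<^sub>M M). \<bar>k (fst z) (snd z)\<bar> * (f (fst z))\<^sup>2) \<le> C * (LINT x|M. (f x)\<^sup>2)"
      (is ?bound)
proof -
  note [measurable] = kernel_measurable L2_measurable[OF f]
  have [measurable]: "(\<lambda>y. k x y) \<in> borel_measurable M" if "x \<in> space M" for x
    using measurable_compose[OF measurable_Pair1'[OF that] kernel_measurable] by simp
  let ?F = "\<lambda>z. \<bar>k (fst z) (snd z)\<bar> * (f (fst z))\<^sup>2"
  have "(\<integral>\<^sup>+ z. ennreal (?F z) \<partial>(M \<Otimes>\<^sub>M M)) = (\<integral>\<^sup>+ x. \<integral>\<^sup>+ y. ennreal (?F (x, y)) \<partial>M \<partial>M)"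
    by (subst nn_integral_fst[symmetric]) auto
  also have "\<dots> = (\<integral>\<^sup>+ x. (\<integral>\<^sup>+ y. ennreal \<bar>k x y\<bar> \<partial>M) * ennreal ((f x)\<^sup>2) \<partial>M)"
    by (intro nn_integral_cong) (simp add: ennreal_mult nn_integral_multc)
  also have "\<dots> \<le> (\<integral>\<^sup>+ x. ennreal C * ennreal ((f x)\<^sup>2) \<partial>M)"
    by (intro nn_integral_mono mult_right_mono row_bound) auto
  also have "\<dots> = ennreal (C * (LINT x|M. (f x)\<^sup>2))"
    using C_nonneg L2_square_integrable[OF f]
    by (simp add: nn_integral_cmult nn_integral_eq_integral ennreal_mult)
  finally have le: "(\<integral>\<^sup>+ z. ennreal (?F z) \<partial>(M \<Otimes>\<^sub>M M)) \<le> ennreal (C * (LINT x|M. (f x)\<^sup>2))" .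
  show ?int
    using le by (intro integrableI_nonneg) (auto intro: le_less_trans)
  then show ?bound
    using le C_nonneg by (simp add: nn_integral_eq_integral)
qed

lemma weighted_square_swapped:
  assumes f: "f \<in> L2 M"
  shows "integrable (M \<Otimes>\<^sub>M M) (\<lambda>z. \<bar>k (fst z) (snd z)\<bar> * (f (snd z))\<^sup>2)" (is ?int)
    and "(LINT z|(M \<Otimes>\<^sub>M M). \<bar>k (fst z) (snd z)\<bar> * (f (snd z))\<^sup>2) \<le> C * (LINT x|M. (f x)\<^sup>2)"
      (is ?bound)
proof -
  let ?F = "\<lambda>z. \<bar>k (fst z) (snd z)\<bar> * (f (fst z))\<^sup>2"
  let ?G = "\<lambda>z. \<bar>k (fst z) (snd z)\<bar> * (f (snd z))\<^sup>2"
  have eq: "(case z of (x, y) \<Rightarrow> ?F (y, x)) = ?G z" if "z \<in> space (M \<Otimes>\<^sub>M M)" for z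
    using that by (auto simp: space_pair_measure kernel_symmetric)
  have "integrable (M \<Otimes>\<^sub>M M) (\<lambda>(x, y). ?F (y, x))"
    by (rule P.integrable_product_swap[OF weighted_square(1)[OF f]])
  then show ?int
    using Bochner_Integration.integrable_cong[OF refl eq, of "M \<Otimes>\<^sub>M M" "\<lambda>z. z"] by simp
  have "integral\<^sup>L (M \<Otimes>\<^sub>M M) ?G = (LINT (x, y)|(M \<Otimes>\<^sub>M M). ?F (y, x))"
    by (rule Bochner_Integration.integral_cong[OF refl eq[symmetric]])
  also have "\<dots> = integral\<^sup>L (M \<Otimes>\<^sub>M M) ?F"
    by (rule P.integral_product_swap) (use weighted_square(1)[OF f] in auto)
  finally show ?bound
    using weighted_square(2)[OF f] by simp
qed

text \<open>Schur's test: \<open>\<bar>f x\<bar> * \<bar>g y\<bar>\<close> is at most the mean of \<open>(f x)\<^sup>2\<close> and \<open>(g y)\<^sup>2\<close>, and the kernel weighs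
  the first by its rows and the second by its columns.\<close>

lemma kernel_form_bound:
  assumes f: "f \<in> L2 M" and g: "g \<in> L2 M"
  shows "integrable (M \<Otimes>\<^sub>M M) (\<lambda>z. k (fst z) (snd z) * f (fst z) * g (snd z))" (is ?int)
    and "\<bar>kernel_form M k f g\<bar> \<le> C * ((LINT x|M. (f x)\<^sup>2) + (LINT x|M. (g x)\<^sup>2)) / 2"
      (is ?bound)
proof -
  note [measurable] = kernel_measurable L2_measurable[OF f] L2_measurable[OF g]
  let ?F = "\<lambda>z. \<bar>k (fst z) (snd z)\<bar> * (f (fst z))\<^sup>2"
  let ?G = "\<lambda>z. \<bar>k (fst z) (snd z)\<bar> * (g (snd z))\<^sup>2"
  let ?H = "\<lambda>z. k (fst z) (snd z) * f (fst z) * g (snd z)"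
  have FG: "integrable (M \<Otimes>\<^sub>M M) (\<lambda>z. (?F z + ?G z) / 2)"
    using weighted_square(1)[OF f] weighted_square_swapped(1)[OF g] by simp
  have le: "\<bar>?H z\<bar> \<le> (?F z + ?G z) / 2" for z
  proof -
    have "\<bar>f (fst z) * g (snd z)\<bar> \<le> ((f (fst z))\<^sup>2 + (g (snd z))\<^sup>2) / 2"
      using sum_squares_bound[of "\<bar>f (fst z)\<bar>" "\<bar>g (snd z)\<bar>"] by (simp add: abs_mult)
    from mult_left_mono[OF this, of "\<bar>k (fst z) (snd z)\<bar>"] show ?thesis
      by (simp add: abs_mult algebra_simps add_divide_distrib)
  qed
  show int: ?int
    using le by (intro Bochner_Integration.integrable_bound[OF FG]) (auto intro: order_trans[OF _ abs_ge_self])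
  have "\<bar>kernel_form M k f g\<bar> \<le> (LINT z|(M \<Otimes>\<^sub>M M). \<bar>?H z\<bar>)"
    unfolding kernel_form_def by (rule integral_abs_bound)
  also have "\<dots> \<le> (LINT z|(M \<Otimes>\<^sub>M M). (?F z + ?G z) / 2)"
    using int FG le by (intro integral_mono) auto
  also have "\<dots> = (integral\<^sup>L (M \<Otimes>\<^sub>M M) ?F + integral\<^sup>L (M \<Otimes>\<^sub>M M) ?G) / 2"
    using weighted_square(1)[OF f] weighted_square_swapped(1)[OF g] by simp
  also have "\<dots> \<le> C * ((LINT x|M. (f x)\<^sup>2) + (LINT x|M. (g x)\<^sup>2)) / 2"
    using weighted_square(2)[OF f] weighted_square_swapped(2)[OF g] by (simp add: algebra_simps)
  finally show ?bound .
qed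

lemma kernel_form_iterated:
  assumes f: "f \<in> L2 M" and g: "g \<in> L2 M"
  shows "kernel_form M k f g = (LINT x|M. f x * (LINT y|M. k x y * g y))"
proof -
  have "kernel_form M k f g = (LINT x|M. LINT y|M. k x y * f x * g y)"
    unfolding kernel_form_def
    using P.integral_fst'[OF kernel_form_bound(1)[OF f g]] by simp
  also have "\<dots> = (LINT x|M. f x * (LINT y|M. k x y * g y))"
    by (subst integral_mult_right_zero[symmetric]) (simp only: mult.left_commute mult.assoc)
  finally show ?thesis .
qed

lemma kernel_form_commute:
  assumes f: "f \<in> L2 M" and g: "g \<in> L2 M"
  shows "kernel_form M k f g = kernel_form M k g f"
proof -
  let ?H = "\<lambda>z. k (fst z) (snd z) * f (fst z) * g (snd z)"
  have "kernel_form M k f g = (LINT (x, y)|(M \<Otimes>\<^sub>M M). ?H (y, x))"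
    unfolding kernel_form_def
    by (rule P.integral_product_swap[symmetric]) (use kernel_form_bound(1)[OF f g] in auto)
  also have "\<dots> = kernel_form M k g f"
    unfolding kernel_form_def
    by (rule Bochner_Integration.integral_cong) (auto simp: space_pair_measure kernel_symmetric)
  finally show ?thesis .
qed

lemma kernel_form_lincomb:
  fixes a b :: real
  assumes f: "f \<in> L2 M" and g: "g \<in> L2 M"
  defines "h \<equiv> \<lambda>x. a * f x + b * g x"
  shows "kernel_form M k h h
    = a\<^sup>2 * kernel_form M k f f + 2 * a * b * kernel_form M k f g + b\<^sup>2 * kernel_form M k g g"
proof -
  let ?H = "\<lambda>f g z. k (fst z) (snd z) * f (fst z) * g (snd z)"
  have "kernel_form M k h h = (LINT z|(M \<Otimes>\<^sub>M M).
      a\<^sup>2 * ?H f f z + a * b * ?H f g z + a * b * ?H g f z + b\<^sup>2 * ?H g g z)"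
    unfolding kernel_form_def h_def
    by (intro Bochner_Integration.integral_cong refl) (simp add: power2_eq_square algebra_simps)
  also have "\<dots> = a\<^sup>2 * kernel_form M k f f + a * b * kernel_form M k f g
      + a * b * kernel_form M k g f + b\<^sup>2 * kernel_form M k g g"
    unfolding kernel_form_def
    using kernel_form_bound(1)[OF f f] kernel_form_bound(1)[OF f g]
      kernel_form_bound(1)[OF g f] kernel_form_bound(1)[OF g g]
    by simp
  finally show ?thesis
    by (simp add: kernel_form_commute[OF g f])
qed

lemma kernel_form_eigenfunction:
  assumes f: "f \<in> L2 M" and g: "g \<in> eigenspace M (kernel_operator M k) \<nu>"
  shows "kernel_form M k f g = \<nu> * (LINT x|M. f x * g x)"
proof -
  have gL: "g \<in> L2 M" and ae: "AE x in M. kernel_operator M k g x = \<nu> * g x"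
    using g by (auto simp: eigenspace_def)
  note [measurable] = L2_measurable[OF f] L2_measurable[OF gL]
  have "kernel_form M k f g = (LINT x|M. f x * kernel_operator M k g x)"
    unfolding kernel_operator_def by (rule kernel_form_iterated[OF f gL])
  also have "\<dots> = (LINT x|M. \<nu> * (f x * g x))"
  proof (rule integral_cong_AE)
    have "(\<lambda>x. kernel_operator M k g x) \<in> borel_measurable M"
      unfolding kernel_operator_def using kernel_measurable
      by (intro borel_measurable_lebesgue_integral) (simp add: case_prod_beta')
    then show "(\<lambda>x. f x * kernel_operator M k g x) \<in> borel_measurable M" by simp
  qed (use ae in auto)
  finally show ?thesis by simp
qed

lemma eigenfunctions_orthogonal:
  assumes f: "f \<in> eigenspace M (kernel_operator M k) \<mu>"
    and g: "g \<in> eigenspace M (kernel_operator M k) \<nu>" and "\<mu> \<noteq> \<nu>"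
  shows "(LINT x|M. f x * g x) = 0"
proof -
  have fL: "f \<in> L2 M" and gL: "g \<in> L2 M" using f g by (auto simp: eigenspace_def)
  have "\<nu> * (LINT x|M. f x * g x) = \<mu> * (LINT x|M. f x * g x)"
    using kernel_form_eigenfunction[OF fL g] kernel_form_eigenfunction[OF gL f]
      kernel_form_commute[OF fL gL] by (auto simp: mult.commute[of "g _"])
  with \<open>\<mu> \<noteq> \<nu>\<close> show ?thesis by simp
qed

text \<open>The part of the min-max principle that concerns two eigenfunctions: in the orthogonal case the
  form is diagonal on their span, and for equal eigenvalues the whole span is in one eigenspace.\<close>

lemma kernel_form_span_lower_bound:
  fixes a b :: real
  assumes f: "f \<in> eigenspace M (kernel_operator M k) \<mu>"
    and g: "g \<in> eigenspace M (kernel_operator M k) \<nu>"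
    and "t \<le> \<mu>" "t \<le> \<nu>"
  defines "h \<equiv> \<lambda>x. a * f x + b * g x"
  shows "t * (LINT x|M. (h x)\<^sup>2) \<le> kernel_form M k h h"
proof -
  have fL: "f \<in> L2 M" and gL: "g \<in> L2 M" using f g by (auto simp: eigenspace_def)
  define F where "F = (LINT x|M. (f x)\<^sup>2)"
  define G where "G = (LINT x|M. (g x)\<^sup>2)"
  define X where "X = (LINT x|M. f x * g x)"
  have FG: "F \<ge> 0" "G \<ge> 0" by (auto simp: F_def G_def)
  have norm_h: "(LINT x|M. (h x)\<^sup>2) = a\<^sup>2 * F + 2 * a * b * X + b\<^sup>2 * G"
  proof -
    have "(LINT x|M. (h x)\<^sup>2)
        = (LINT x|M. a\<^sup>2 * (f x)\<^sup>2 + 2 * a * b * (f x * g x) + b\<^sup>2 * (g x)\<^sup>2)"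
      unfolding h_def by (simp add: power2_eq_square algebra_simps)
    then show ?thesis
      using L2_square_integrable[OF fL] L2_square_integrable[OF gL] integrable_mult_L2[OF fL gL]
      by (simp add: F_def G_def X_def)
  qed
  have form_h: "kernel_form M k h h = a\<^sup>2 * \<mu> * F + 2 * a * b * (\<nu> * X) + b\<^sup>2 * \<nu> * G"
    unfolding h_def kernel_form_lincomb[OF fL gL]
    using kernel_form_eigenfunction[OF fL f] kernel_form_eigenfunction[OF fL g]
      kernel_form_eigenfunction[OF gL g]
    by (simp add: F_def G_def X_def power2_eq_square)
  show ?thesis
  proof (cases "\<mu> = \<nu>")
    case True
    have "0 \<le> (LINT x|M. (h x)\<^sup>2)" by simp
    with \<open>t \<le> \<nu>\<close> have "t * (LINT x|M. (h x)\<^sup>2) \<le> \<nu> * (LINT x|M. (h x)\<^sup>2)"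
      by (rule mult_right_mono)
    then show ?thesis using True by (simp add: form_h norm_h algebra_simps)
  next
    case False
    then have "X = 0" using eigenfunctions_orthogonal[OF f g] by (simp add: X_def)
    moreover have "t * (a\<^sup>2 * F) \<le> \<mu> * (a\<^sup>2 * F)" "t * (b\<^sup>2 * G) \<le> \<nu> * (b\<^sup>2 * G)"
      using FG assms(3,4) by (auto intro!: mult_right_mono)
    ultimately show ?thesis by (simp add: form_h norm_h algebra_simps)
  qed
qed

text \<open>On the orthogonal complement of \<open>\<phi>\<close> the rank-one kernel \<open>\<phi>(x) \<phi>(y)\<close> has zero form, so the kernel may
  be replaced by the difference, whose rows can be much smaller.\<close>

lemma kernel_form_upper_bound:
  assumes \<phi>: "\<phi> \<in> L2 M"
    and perturbed: "symmetric_kernel M (\<lambda>x y. k x y - \<phi> x * \<phi> y) A"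
    and h: "h \<in> L2 M" and orth: "(LINT x|M. \<phi> x * h x) = 0"
  shows "kernel_form M k h h \<le> A * (LINT x|M. (h x)\<^sup>2)"
proof -
  interpret Q: symmetric_kernel M "\<lambda>x y. k x y - \<phi> x * \<phi> y" A by (rule perturbed)
  let ?H = "\<lambda>k z. k (fst z) (snd z) * h (fst z) * h (snd z)"
  let ?R = "\<lambda>x y. \<phi> x * \<phi> y"
  \<comment> \<open>The form of the rank-one kernel converges as the difference of two forms that converge by Schur's test.\<close>
  have "integrable (M \<Otimes>\<^sub>M M) (\<lambda>z. ?H k z - ?H (\<lambda>x y. k x y - ?R x y) z)"
    using kernel_form_bound(1)[OF h h] Q.kernel_form_bound(1)[OF h h]
    by (rule Bochner_Integration.integrable_diff)
  then have R: "integrable (M \<Otimes>\<^sub>M M) (?H ?R)"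
    by (simp add: algebra_simps)
  have "kernel_form M ?R h h = (LINT x|M. LINT y|M. (\<phi> x * h x) * (\<phi> y * h y))"
    unfolding kernel_form_def using P.integral_fst'[OF R] by (simp add: mult_ac)
  also have "\<dots> = 0" by (simp add: orth)
  finally have "kernel_form M k h h = kernel_form M (\<lambda>x y. k x y - ?R x y) h h"
    using kernel_form_bound(1)[OF h h] R
    by (simp add: kernel_form_def left_diff_distrib)
  also have "\<dots> \<le> A * (LINT x|M. (h x)\<^sup>2)"
    using Q.kernel_form_bound(2)[OF h h] by simp
  finally show ?thesis .
qed

text \<open>Weyl's inequality for a perturbation of rank one, with the largest eigenvalue of the perturbed
  operator replaced by its Schur bound. A plane always meets the orthogonal complement of one
  function \<open>\<phi>\<close> in a nonzero vector, and there the two bounds on the form are compared.\<close>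

lemma second_eigenvalue_le:
  assumes \<phi>: "\<phi> \<in> L2 M"
    and perturbed: "symmetric_kernel M (\<lambda>x y. k x y - \<phi> x * \<phi> y) A"
  shows "nth_eigenvalue M (kernel_operator M k) 2 \<le> A"
proof -
  interpret Q: symmetric_kernel M "\<lambda>x y. k x y - \<phi> x * \<phi> y" A by (rule perturbed)
  have "t \<le> A" if count: "2 \<le> eigenvalue_count M (kernel_operator M k) t" for t
  proof -
    obtain \<mu> \<nu> f g where t: "t \<le> \<mu>" "t \<le> \<nu>"
      and f: "f \<in> eigenspace M (kernel_operator M k) \<mu>"
      and g: "g \<in> eigenspace M (kernel_operator M k) \<nu>"
      and cases: "\<mu> = \<nu> \<and> (\<forall>a b. (AE x in M. a * f x + b * g x = 0) \<longrightarrow> a = 0 \<and> b = 0)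
        \<or> \<mu> \<noteq> \<nu> \<and> \<not> (AE x in M. f x = 0) \<and> \<not> (AE x in M. g x = 0)"
      using two_eigenfunctions_of_eigenvalue_count[OF count] by blast
    have fL: "f \<in> L2 M" and gL: "g \<in> L2 M" using f g by (auto simp: eigenspace_def)
    have indep: "a = 0 \<and> b = 0" if ae: "AE x in M. a * f x + b * g x = 0" for a b
    proof (cases "\<mu> = \<nu>")
      case True
      with cases ae show ?thesis by blast
    next
      case False
      have X: "(LINT x|M. f x * g x) = 0" by (rule eigenfunctions_orthogonal[OF f g False])
      have "0 = (LINT x|M. f x * (a * f x + b * g x))"
        by (subst integral_cong_AE[where g = "\<lambda>_. 0"])
          (use ae L2_measurable[OF fL] L2_measurable[OF gL] in auto)
      also have "\<dots> = (LINT x|M. a * (f x)\<^sup>2 + b * (f x * g x))"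
        by (simp add: power2_eq_square algebra_simps)
      also have "\<dots> = a * (LINT x|M. (f x)\<^sup>2)"
        using L2_square_integrable[OF fL] integrable_mult_L2[OF fL gL] by (simp add: X)
      finally have "a = 0" using cases False L2_norm_eq_0_iff[OF fL] by simp
      moreover from this ae have "b = 0" using cases False by auto
      ultimately show ?thesis by simp
    qed
    define p q where "p = (LINT x|M. \<phi> x * f x)" and "q = (LINT x|M. \<phi> x * g x)"
    obtain a b where ab: "a * p + b * q = 0" "\<not> (a = 0 \<and> b = 0)"
    proof (cases "p = 0 \<and> q = 0")
      case True
      then show thesis using that[of 1 0] by simp
    next
      case False
      then show thesis using that[of q "- p"] by auto
    qed
    define h where "h x = a * f x + b * g x" for x
    have h: "h \<in> L2 M" unfolding h_def by (rule lincomb_L2[OF fL gL])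
    have "(LINT x|M. \<phi> x * h x) = (LINT x|M. a * (\<phi> x * f x) + b * (\<phi> x * g x))"
      by (simp add: h_def algebra_simps)
    also have "\<dots> = 0"
      using integrable_mult_L2[OF \<phi> fL] integrable_mult_L2[OF \<phi> gL] ab(1)
      by (simp add: p_def q_def)
    finally have "kernel_form M k h h \<le> A * (LINT x|M. (h x)\<^sup>2)"
      by (rule kernel_form_upper_bound[OF \<phi> perturbed h])
    moreover have "t * (LINT x|M. (h x)\<^sup>2) \<le> kernel_form M k h h"
      using kernel_form_span_lower_bound[OF f g t, of a b] by (simp add: h_def[abs_def])
    moreover have "(LINT x|M. (h x)\<^sup>2) > 0"
    proof -
      have "\<not> (AE x in M. h x = 0)" using indep ab(2) unfolding h_def by blast
      then have "(LINT x|M. (h x)\<^sup>2) \<noteq> 0" using L2_norm_eq_0_iff[OF h] by simp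
      moreover have "(LINT x|M. (h x)\<^sup>2) \<ge> 0" by simp
      ultimately show ?thesis by linarith
    qed
    ultimately show "t \<le> A"
      by (meson mult_right_le_imp_le order_trans)
  qed
  then show ?thesis
    unfolding nth_eigenvalue_def using Q.C_nonneg
    by (intro cSup_least) (auto simp: numeral_eq_enat)
qed

end

section \<open>The rows of the perturbed kernel\<close>

text \<open>The primitive of \<open>\<bar>t powr (-1/2) - 2\<bar>\<close> on \<open>t \<ge> 0\<close> that vanishes at \<open>0\<close>. The integrand changes sign
  at \<open>1/4\<close>; the constant \<open>1\<close> in the second branch makes the branches agree there.\<close>

definition half_row :: "real \<Rightarrow> real" where
  "half_row t = (if t \<le> 1/4 then 2 * sqrt t - 2 * t else 1 - 2 * sqrt t + 2 * t)"

lemma continuous_on_half_row: "continuous_on UNIV half_row"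
proof -
  have *: "sqrt (1/4) = 1/2" by (rule real_sqrt_unique) (auto simp: power2_eq_square)
  have "continuous_on ({..1/4} \<union> {1/4..}) half_row"
    unfolding half_row_def[abs_def]
  proof (rule continuous_on_If)
    fix x :: real
    assume "x \<in> {..1/4}" "\<not> x \<le> 1/4" 
    then show "2 * sqrt x - 2 * x = 1 - 2 * sqrt x + 2 * x" by simp
  next
    fix x :: real
    assume "x \<in> {1/4..}" "x \<le> 1/4"
    then have x: "x = 1/4" by simp
    show "2 * sqrt x - 2 * x = 1 - 2 * sqrt x + 2 * x" unfolding x * by simp
  qed (auto intro!: continuous_intros)
  moreover have "{..1/4} \<union> {1/4..} = (UNIV :: real set)" by auto
  ultimately show ?thesis by simp
qed

lemma half_row_derivative:
  assumes "t > 0" "t \<noteq> 1/4"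
  shows "(half_row has_real_derivative \<bar>t powr (-1/2) - 2\<bar>) (at t)"
proof -
  have *: "sqrt (1/4) = 1/2" by (rule real_sqrt_unique) (auto simp: power2_eq_square)
  have pw: "t powr - (1/2) = inverse (sqrt t)"
    using assms(1) by (simp add: powr_minus powr_half_sqrt)
  show ?thesis
  proof (cases "t < 1/4")
    case True
    have "sqrt t < 1/2" using True * by (metis real_sqrt_less_iff)
    then have "2 \<le> inverse (sqrt t)" using assms(1) by (simp add: field_simps)
    moreover have "((\<lambda>t. 2 * sqrt t - 2 * t) has_real_derivative inverse (sqrt t) - 2) (at t)"
      using assms(1) by (auto intro!: derivative_eq_intros)
    moreover have "(half_row has_real_derivative D) (at t) \<longleftrightarrow>
        ((\<lambda>t. 2 * sqrt t - 2 * t) has_real_derivative D) (at t)" for D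
      using True eventually_nhds_in_open[of "{..<1/4}" t]
      by (intro DERIV_cong_ev refl) (auto simp: half_row_def elim: eventually_mono)
    ultimately show ?thesis by (simp add: pw)
  next
    case False
    have "sqrt t > 1/2" using False assms * by (metis linorder_neqE_linordered_idom real_sqrt_less_iff)
    then have "2 \<ge> inverse (sqrt t)" using assms(1) by (simp add: field_simps)
    moreover have "((\<lambda>t. 1 - 2 * sqrt t + 2 * t) has_real_derivative 2 - inverse (sqrt t)) (at t)"
      using assms(1) by (auto intro!: derivative_eq_intros)
    moreover have "(half_row has_real_derivative D) (at t) \<longleftrightarrow>
        ((\<lambda>t. 1 - 2 * sqrt t + 2 * t) has_real_derivative D) (at t)" for D
      using False assms eventually_nhds_in_open[of "{1/4<..}" t]
      by (intro DERIV_cong_ev refl) (auto simp: half_row_def elim: eventually_mono)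
    ultimately show ?thesis by (simp add: pw)
  qed
qed

text \<open>The diagonal splits the row at \<open>x\<close> into pieces of length \<open>x\<close> and \<open>1 - x\<close>. The fundamental theorem
  of calculus applies to each, since the primitive is continuous and fails to be differentiable, if
  at all, only at the end of the piece and where the kernel crosses \<open>2\<close>.\<close>

lemma row_integral:
  assumes x: "0 < x" "x < 1"
  shows "((\<lambda>y. \<bar>\<bar>x - y\<bar> powr (-1/2) - 2\<bar>) has_integral half_row x + half_row (1 - x)) {0..1}"
proof -
  have P0: "half_row 0 = 0" by (simp add: half_row_def)
  have left: "((\<lambda>y. \<bar>\<bar>x - y\<bar> powr (-1/2) - 2\<bar>) has_integral
      (- half_row (x - x)) - (- half_row (x - 0))) {0..x}"
  proof (rule fundamental_theorem_of_calculus_interior_strong[where S = "{x - 1/4}"])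
    show "continuous_on {0..x} (\<lambda>y. - half_row (x - y))"
      by (intro continuous_intros continuous_on_compose2[OF continuous_on_half_row]) auto
    fix y assume y: "y \<in> {0<..<x} - {x - 1/4}"
    have "((\<lambda>y. x - y) has_real_derivative -1) (at y)"
      by (auto intro!: derivative_eq_intros)
    from DERIV_minus[OF DERIV_chain2
        [where f = half_row and g = "\<lambda>y. x - y" and x = y, OF half_row_derivative this]] y
    have "((\<lambda>y. - half_row (x - y)) has_real_derivative \<bar>(x - y) powr (-1/2) - 2\<bar>) (at y)"
      by simp
    then show "((\<lambda>y. - half_row (x - y)) has_vector_derivative \<bar>\<bar>x - y\<bar> powr (-1/2) - 2\<bar>) (at y)"
      using y by (simp add: has_real_derivative_iff_has_vector_derivative)
  qed (use x in auto)
  have right: "((\<lambda>y. \<bar>\<bar>x - y\<bar> powr (-1/2) - 2\<bar>) has_integral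
      half_row (1 - x) - half_row (x - x)) {x..1}"
  proof (rule fundamental_theorem_of_calculus_interior_strong[where S = "{x + 1/4}"])
    show "continuous_on {x..1} (\<lambda>y. half_row (y - x))"
      by (intro continuous_intros continuous_on_compose2[OF continuous_on_half_row]) auto
    fix y assume y: "y \<in> {x<..<1} - {x + 1/4}"
    have "((\<lambda>y. y - x) has_real_derivative 1) (at y)"
      by (auto intro!: derivative_eq_intros)
    from DERIV_chain2
        [where f = half_row and g = "\<lambda>y. y - x" and x = y, OF half_row_derivative this] y
    have "((\<lambda>y. half_row (y - x)) has_real_derivative \<bar>(y - x) powr (-1/2) - 2\<bar>) (at y)"
      by simp
    then show "((\<lambda>y. half_row (y - x)) has_vector_derivative \<bar>\<bar>x - y\<bar> powr (-1/2) - 2\<bar>) (at y)"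
      using y by (simp add: has_real_derivative_iff_has_vector_derivative)
  qed (use x in auto)
  show ?thesis
    using has_integral_combine[OF _ _ left right] x P0 by simp
qed

text \<open>The value \<open>s = (sqrt 3 + 1) / 8\<close> is the value of \<open>sqrt x\<close> at which \<open>2 sqrt x - 4 (sqrt 3 - 1) x\<close> is maximal,
  and it is also the maximal value.\<close>

lemma row_bound_near_end:
  assumes x: "0 \<le> x" "x \<le> 1/4"
  shows "half_row x + half_row (1 - x) \<le> (9 + sqrt 3) / 8"
proof -
  define r where "r = sqrt 3"
  have r: "r\<^sup>2 = 3" "1 < r" "r < 2" by (auto simp: r_def real_less_lsqrt)
  define s where "s = (r + 1) / 8"
  have s: "s > 0" "s * (4 * (r - 1)) = 1"
    using r by (auto simp: s_def power2_eq_square field_simps)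
  have root: "2 * sqrt x \<le> 4 * (r - 1) * x + s"
  proof -
    have "0 \<le> (sqrt x - s)\<^sup>2 * (4 * (r - 1))" using r by simp
    also have "\<dots> = x * (4 * (r - 1)) - 2 * sqrt x * (s * (4 * (r - 1))) + s * (s * (4 * (r - 1)))"
      using x by (simp add: power2_eq_square algebra_simps)
    finally show ?thesis unfolding s(2) by (simp add: algebra_simps)
  qed
  \<comment> \<open>The chord of \<open>sqrt (1 - x)\<close> over \<open>[0, 1/4]\<close>, which ends at \<open>sqrt (3/4) = r / 2\<close>.\<close>
  have chord: "1 - 2 * (2 - r) * x \<le> sqrt (1 - x)"
  proof (rule real_le_rsqrt)
    have "(1 - x) - (1 - 2 * (2 - r) * x)\<^sup>2 - (2 - r)\<^sup>2 * (x * (1 - 4 * x)) = (r\<^sup>2 - 3) * - x"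
      by (simp add: power2_eq_square algebra_simps)
    moreover have "0 \<le> (2 - r)\<^sup>2 * (x * (1 - 4 * x))" using x by simp
    ultimately show "(1 - 2 * (2 - r) * x)\<^sup>2 \<le> 1 - x" using r(1) by simp
  qed
  have "half_row x + half_row (1 - x) = 2 * sqrt x - 2 * x + (1 - 2 * sqrt (1 - x) + 2 * (1 - x))"
    using x by (simp add: half_row_def)
  also have "\<dots> \<le> 1 + s" using root chord by (simp add: algebra_simps)
  also have "\<dots> = (9 + sqrt 3) / 8" by (simp add: s_def r_def field_simps)
  finally show ?thesis .
qed

text \<open>Both pieces of the row now reach \<open>1/4\<close>, so the row integral decreases in the concave function
  \<open>sqrt x + sqrt (1 - x)\<close>, which on \<open>[1/4, 3/4]\<close> is smallest at the ends.\<close>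

lemma row_bound_middle:
  assumes x: "1/4 \<le> x" "x \<le> 3/4"
  shows "half_row x + half_row (1 - x) \<le> (9 + sqrt 3) / 8"
proof -
  have sum: "(1 + sqrt 3) / 2 \<le> sqrt x + sqrt (1 - x)"
  proof (rule power2_le_imp_le)
    have "sqrt 3 / 4 \<le> sqrt x * sqrt (1 - x)"
      unfolding real_sqrt_mult[symmetric]
    proof (rule real_le_rsqrt)
      have "0 \<le> (x - 1/4) * (3/4 - x)" using x by simp
      then show "(sqrt 3 / 4)\<^sup>2 \<le> x * (1 - x)" by (simp add: power_divide field_simps)
    qed
    then show "((1 + sqrt 3) / 2)\<^sup>2 \<le> (sqrt x + sqrt (1 - x))\<^sup>2"
      using x by (simp add: power2_sum power_divide field_simps)
  qed (use x in auto)
  have half: "sqrt (1/4) = 1/2" by (rule real_sqrt_unique) (auto simp: power2_eq_square)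
  have eq: "half_row t = 1 - 2 * sqrt t + 2 * t" if "1/4 \<le> t" for t
    using that half by (cases "t = 1/4") (simp_all add: half_row_def del: divide_const_simps)
  have "half_row x + half_row (1 - x) = 4 - 2 * (sqrt x + sqrt (1 - x))" using x by (simp add: eq)
  moreover have "5 / 3 \<le> sqrt 3" by (rule real_le_rsqrt) (simp add: power2_eq_square)
  ultimately show ?thesis using sum by (simp add: field_simps)
qed

lemma row_bound_01:
  assumes "0 \<le> x" "x \<le> 1"
  shows "half_row x + half_row (1 - x) \<le> (9 + sqrt 3) / 8"
  using row_bound_near_end[of x] row_bound_middle[of x] row_bound_near_end[of "1 - x"] assms
  by (cases "x \<le> 1/4"; cases "x \<le> 3/4") (auto simp: add.commute)

lemma row_nn_integral:
  assumes x: "0 < x" "x < 1"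
  shows "(\<integral>\<^sup>+ y. ennreal \<bar>\<bar>x - y\<bar> powr (-1/2) - 2\<bar> \<partial>lborel01) \<le> ennreal ((9 + sqrt 3) / 8)"
proof -
  let ?f = "\<lambda>y. \<bar>\<bar>x - y\<bar> powr (-1/2) - 2\<bar>"
  have "(\<integral>\<^sup>+ y. ennreal (?f y) \<partial>lborel01) = (\<integral>\<^sup>+ y. ennreal (?f y) * indicator {0<..<1} y \<partial>lborel)"
    unfolding lborel01_def by (subst nn_integral_restrict_space) auto
  also have "\<dots> \<le> (\<integral>\<^sup>+ y. ennreal (indicator {0..1} y * ?f y) \<partial>lborel)"
    by (intro nn_integral_mono) (auto simp: indicator_def)
  also have "\<dots> = ennreal (half_row x + half_row (1 - x))"
  proof (rule nn_integral_has_integral_lborel)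
    have "(\<lambda>y. indicator {0..1} y * ?f y) = (\<lambda>y. if y \<in> {0..1} then ?f y else 0)"
      by (auto simp: indicator_def)
    then show "((\<lambda>y. indicator {0..1} y * ?f y) has_integral half_row x + half_row (1 - x)) UNIV"
      using row_integral[OF x] by (simp only: has_integral_restrict_UNIV)
  qed auto
  also have "\<dots> \<le> ennreal ((9 + sqrt 3) / 8)"
    using row_bound_01[of x] x by (intro ennreal_leI) auto
  finally show ?thesis .
qed

section \<open>The second eigenvalue\<close>

text \<open>The second bound is crude; its role is to make the forms of \<open>K_star\<close> converge.\<close>

lemma symmetric_kernel_abs_powr_diff:
  shows "symmetric_kernel lborel01 (\<lambda>x y. \<bar>x - y\<bar> powr (-1/2) - 2) ((9 + sqrt 3) / 8)"
    and "symmetric_kernel lborel01 (\<lambda>x y. \<bar>x - y\<bar> powr (-1/2)) ((9 + sqrt 3) / 8 + 2)"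
proof -
  have space: "space lborel01 = {0<..<1}"
    by (simp add: lborel01_def space_restrict_space)
  have [measurable]: "(\<lambda>x. x) \<in> borel_measurable lborel01"
    unfolding lborel01_def by (intro measurable_restrict_space1) simp
  have mass: "emeasure lborel01 (space lborel01) = 1"
    by (simp add: space) (simp add: lborel01_def emeasure_restrict_space)
  interpret finite_measure lborel01
    by (rule finite_measureI) (simp add: mass)
  have row: "(\<integral>\<^sup>+ y. ennreal \<bar>\<bar>x - y\<bar> powr (-1/2) - 2\<bar> \<partial>lborel01) \<le> ennreal ((9 + sqrt 3) / 8)"
    if "x \<in> space lborel01" for x
    using row_nn_integral[of x] that by (simp add: space)
  have coords: "fst \<in> borel_measurable (lborel01 \<Otimes>\<^sub>M lborel01)"
    "snd \<in> borel_measurable (lborel01 \<Otimes>\<^sub>M lborel01)"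
    by measurable
  show "symmetric_kernel lborel01 (\<lambda>x y. \<bar>x - y\<bar> powr (-1/2) - 2) ((9 + sqrt 3) / 8)"
    using row coords by unfold_locales (auto simp: abs_minus_commute)
  have triangle: "ennreal \<bar>p\<bar> \<le> ennreal \<bar>p - 2\<bar> + ennreal 2" for p :: real
  proof -
    have "ennreal \<bar>p\<bar> \<le> ennreal (\<bar>p - 2\<bar> + 2)" by (intro ennreal_leI) auto
    also have "\<dots> = ennreal \<bar>p - 2\<bar> + ennreal 2" by (rule ennreal_plus) auto
    finally show ?thesis .
  qed
  have "(\<integral>\<^sup>+ y. ennreal \<bar>\<bar>x - y\<bar> powr (-1/2)\<bar> \<partial>lborel01) \<le> ennreal ((9 + sqrt 3) / 8 + 2)"
    if x: "x \<in> space lborel01" for x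
  proof -
    have "(\<integral>\<^sup>+ y. ennreal \<bar>\<bar>x - y\<bar> powr (-1/2)\<bar> \<partial>lborel01)
        \<le> (\<integral>\<^sup>+ y. ennreal \<bar>\<bar>x - y\<bar> powr (-1/2) - 2\<bar> + ennreal 2 \<partial>lborel01)"
      by (intro nn_integral_mono triangle)
    also have "\<dots> = (\<integral>\<^sup>+ y. ennreal \<bar>\<bar>x - y\<bar> powr (-1/2) - 2\<bar> \<partial>lborel01) + ennreal 2"
      by (subst nn_integral_add) (auto simp: mass)
    also have "\<dots> \<le> ennreal ((9 + sqrt 3) / 8) + ennreal 2"
      using row[OF x] by (rule add_right_mono)
    also have "\<dots> = ennreal ((9 + sqrt 3) / 8 + 2)"
      by (rule ennreal_plus[symmetric]) auto
    finally show ?thesis .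
  qed
  then show "symmetric_kernel lborel01 (\<lambda>x y. \<bar>x - y\<bar> powr (-1/2)) ((9 + sqrt 3) / 8 + 2)"
    using coords by unfold_locales (auto simp: abs_minus_commute)
qed

theorem lemma5p2:
  shows "nth_eigenvalue lborel01 K_star 2 \<le> (9 + sqrt 3) / 8"
proof -
  interpret symmetric_kernel lborel01 "\<lambda>x y. \<bar>x - y\<bar> powr (-1/2)" "(9 + sqrt 3) / 8 + 2"
    by (rule symmetric_kernel_abs_powr_diff(2))
  have "emeasure lborel01 (space lborel01) \<noteq> \<infinity>"
    by (simp add: lborel01_def space_restrict_space emeasure_restrict_space)
  then have "(\<lambda>_. sqrt 2) \<in> L2 lborel01"
    by (simp add: L2_def finite_measure.integrable_const finite_measureI)
  moreover have "symmetric_kernel lborel01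
      (\<lambda>x y. \<bar>x - y\<bar> powr (-1/2) - sqrt 2 * sqrt 2) ((9 + sqrt 3) / 8)"
    using symmetric_kernel_abs_powr_diff(1) by simp
  ultimately have "nth_eigenvalue lborel01
      (kernel_operator lborel01 (\<lambda>x y. \<bar>x - y\<bar> powr (-1/2))) 2 \<le> (9 + sqrt 3) / 8"
    by (rule second_eigenvalue_le)
  moreover have "kernel_operator lborel01 (\<lambda>x y. \<bar>x - y\<bar> powr (-1/2)) = K_star"
    by (intro ext) (simp add: kernel_operator_def K_star_def)
  ultimately show ?thesis by simp
qed

end
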